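(* Let $\mathcal{I}$ be an ideal on $\omega$. Then, for each $f\in\mathrm{SL}(\mathcal{I})$, there exists a normalized capacity $\rho:\mathscr{B}(\mathrm{Ult}(\mathcal{I}))\to\mathbf{R}$ such that $$\forall x\in\ell_\infty,\quad f(x)=\int_{\mathrm{Ult}(\mathcal{I})}\mathcal{F}\text{-}\lim x\,\mathrm{d}\rho(\mathcal{F}),$$ where the integral is a Choquet integral.
   Context: $\omega$ is the set of nonnegative integers. An ideal on $\omega$ is a family $\mathcal{I}\subseteq\mathcal{P}(\omega)$ closed under finite unions and subsets, with $\omega\notin\mathcal{I}$ and containing all finite subsets of $\omega$. $\ell_\infty$ is the Banach lattice of bounded real sequences with the supremum norm and pointwise order; $c$ is the space of convergent real sequences; $\bm{1}_A$ is the characteristic sequence of $A\subseteq\omega$. $\mathrm{SL}(\mathcal{I})$ is the set of linear functionals $f:\ell_\infty\to\mathbf{R}$ such that: (i) $f(x)\ge 0$ whenever $x\ge 0$; (ii) $f(x)=\lim x$ for all $x\in c$; (iii) $f(\bm{1}_A)=0$ for all $A\in\mathcal{I}$. $\beta\omega$ is the space of ultrafilters on $\omega$ with the topology having as base the clopen sets $\{\mathcal{F}\in\beta\omega:A\in\mathcal{F}\}$, $A\subseteq\omega$. $\mathrm{Ult}(\mathcal{I})$ is the subspace (with relative topology) of those ultrafilters $\mathcal{F}$ on $\omega$ with $\omega\setminus A\in\mathcal{F}$ for all $A\in\mathcal{I}$. For $x\in\ell_\infty$ and an ultrafilter $\mathcal{F}$, $\mathcal{F}\text{-}\lim x$ is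 the unique $\eta\in\mathbf{R}$ with $\{n:|x_n-\eta|<\varepsilon\}\in\mathcal{F}$ for all $\varepsilon>0$. $\mathscr{B}(X)$ is the Borel $\sigma$-algebra of a topological space $X$. A normalized capacity on a measurable space $(S,\Sigma)$ is a set function $\nu:\Sigma\to\mathbf{R}$ with $\nu(\emptyset)=0$, $\nu(S)=1$, and $\nu(A)\le\nu(B)$ whenever $A\subseteq B$. The Choquet integral of a bounded $\Sigma$-measurable function $x:S\to\mathbf{R}$ with respect to $\nu$ is $$\int x\,\mathrm{d}\nu:=\int_0^\infty\nu(x\ge t)\,\mathrm{d}t+\int_{-\infty}^0[\nu(x\ge t)-\nu(S)]\,\mathrm{d}t,$$ where the right-hand side integrals are improper Riemann integrals. *)

theory Defs
  imports "HOL-Analysis.Analysis"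
begin

definition ideal_on_omega :: "nat set set \<Rightarrow> bool" where
  "ideal_on_omega I \<longleftrightarrow>
     (\<forall>A\<in>I. \<forall>B\<in>I. A \<union> B \<in> I) \<and>
     (\<forall>A\<in>I. \<forall>B. B \<subseteq> A \<longrightarrow> B \<in> I) \<and>
     UNIV \<notin> I \<and>
     (\<forall>A. finite A \<longrightarrow> A \<in> I)"

text \<open>Every sequence is continuous for the discrete topology of \<^typ>\<open>nat\<close>, so the bounded
  continuous functions on \<^typ>\<open>nat\<close> are exactly the bounded sequences, with the supremum norm.\<close>

type_synonym linfty = "nat \<Rightarrow>\<^sub>C real"

lemma bounded_sequence_bcontfun:
  fixes x :: "nat \<Rightarrow> real"
  shows "x \<in> bcontfun \<longleftrightarrow> bounded (range x)"
  by (simp add: bcontfun_def)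

definition char_seq :: "nat set \<Rightarrow> linfty" where
  "char_seq A = Bcontfun (indicat_real A)"

lemma apply_char_seq [simp]: "apply_bcontfun (char_seq A) = indicat_real A"
proof -
  have "bounded (range (indicat_real A))"
    by (rule boundedI[of _ 1]) (auto simp: indicator_def)
  then show ?thesis
    by (simp add: char_seq_def Bcontfun_inverse bounded_sequence_bcontfun)
qed

definition SL :: "nat set set \<Rightarrow> (linfty \<Rightarrow> real) set" where
  "SL I = {f. linear f \<and>
     (\<forall>x. (\<forall>n. 0 \<le> apply_bcontfun x n) \<longrightarrow> 0 \<le> f x) \<and>
     (\<forall>x. convergent (apply_bcontfun x) \<longrightarrow> f x = lim (apply_bcontfun x)) \<and>
     (\<forall>A\<in>I. f (char_seq A) = 0)}"

text \<open>A filter on \<open>\<omega>\<close> is a value \<open>F\<close> of type \<^typ>\<open>nat filter\<close>, and \<open>A \<in> F\<close> is written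
  \<^term>\<open>eventually (\<lambda>n. n \<in> A) F\<close>.\<close>

definition ultrafilter :: "nat filter \<Rightarrow> bool" where
  "ultrafilter F \<longleftrightarrow>
     F \<noteq> bot \<and> (\<forall>A. eventually (\<lambda>n. n \<in> A) F \<or> eventually (\<lambda>n. n \<in> - A) F)"

definition ultra_clopen :: "nat set \<Rightarrow> nat filter set" where
  "ultra_clopen A = {F. ultrafilter F \<and> eventually (\<lambda>n. n \<in> A) F}"

definition beta_omega :: "nat filter topology" where
  "beta_omega = topology (arbitrary union_of (\<lambda>U. \<exists>A. U = ultra_clopen A))"

definition Ult :: "nat set set \<Rightarrow> nat filter set" where
  "Ult I = {F. ultrafilter F \<and> (\<forall>A\<in>I. eventually (\<lambda>n. n \<in> - A) F)}"

definition Ult_topology :: "nat set set \<Rightarrow> nat filter topology" where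
  "Ult_topology I = subtopology beta_omega (Ult I)"

text \<open>Only the measurable-space part of a value of type \<^typ>\<open>'a measure\<close> is used here and below;
  its built-in measure plays no role.\<close>

definition borel_algebra :: "'a topology \<Rightarrow> 'a measure" where
  "borel_algebra X = sigma (topspace X) {U. openin X U}"

definition normalized_capacity :: "'a measure \<Rightarrow> ('a set \<Rightarrow> real) \<Rightarrow> bool" where
  "normalized_capacity M \<nu> \<longleftrightarrow>
     \<nu> {} = 0 \<and> \<nu> (space M) = 1 \<and>
     (\<forall>A\<in>sets M. \<forall>B\<in>sets M. A \<subseteq> B \<longrightarrow> \<nu> A \<le> \<nu> B)"

text \<open>For a capacity \<open>\<nu>\<close> and bounded measurable \<open>x\<close> the integrands are monotone and vanish for large
  \<open>\<bar>t\<bar>\<close>. So they are Riemann integrable on compact intervals, where the gauge integral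
  \<^const>\<open>integral\<close> is the Riemann integral, and the limits defining the improper integrals exist.\<close>

definition choquet_integral :: "'a measure \<Rightarrow> ('a set \<Rightarrow> real) \<Rightarrow> ('a \<Rightarrow> real) \<Rightarrow> real" where
  "choquet_integral M \<nu> x =
     Lim at_top (\<lambda>b. integral {0..b} (\<lambda>t. \<nu> {s \<in> space M. x s \<ge> t})) +
     Lim at_bot (\<lambda>a. integral {a..0} (\<lambda>t. \<nu> {s \<in> space M. x s \<ge> t} - \<nu> (space M)))"

text \<open>Well-definedness: the sets \<^const>\<open>ultra_clopen\<close> form a base, ultrafilter limits
  \<^term>\<open>Lim F x\<close> of bounded sequences exist, and \<open>F \<mapsto> Lim F x\<close> is bounded and Borel
  measurable on \<^term>\<open>Ult I\<close>.\<close>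

lemma openin_beta_omega:
  "openin beta_omega = arbitrary union_of (\<lambda>U. \<exists>A. U = ultra_clopen A)"
proof -
  have "\<exists>C. ultra_clopen A \<inter> ultra_clopen B = ultra_clopen C" for A B
    by (rule exI[of _ "A \<inter> B"]) (auto simp: ultra_clopen_def eventually_conj_iff)
  then have "istopology (arbitrary union_of (\<lambda>U. \<exists>A. U = ultra_clopen A))"
    by (intro istopology_base) auto
  then show ?thesis
    by (simp add: beta_omega_def)
qed

lemma openin_ultra_clopen: "openin beta_omega (ultra_clopen A)"
  unfolding openin_beta_omega by (rule arbitrary_union_of_inc) blast

lemma topspace_beta_omega: "topspace beta_omega = {F. ultrafilter F}"
proof
  show "topspace beta_omega \<subseteq> {F. ultrafilter F}"
  proof
    fix F assume "F \<in> topspace beta_omega"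
    then obtain U where "openin beta_omega U" "F \<in> U"
      by (auto simp: topspace_def)
    then show "F \<in> {F. ultrafilter F}"
      by (auto simp: openin_beta_omega union_of_def ultra_clopen_def)
  qed
  show "{F. ultrafilter F} \<subseteq> topspace beta_omega"
    using openin_subset[OF openin_ultra_clopen[of UNIV]] by (auto simp: ultra_clopen_def)
qed

lemma topspace_Ult_topology: "topspace (Ult_topology I) = Ult I"
  by (auto simp: Ult_topology_def topspace_beta_omega Ult_def)

lemma space_borel_Ult: "space (borel_algebra (Ult_topology I)) = Ult I"
  unfolding borel_algebra_def topspace_Ult_topology[symmetric]
  by (rule space_measure_of) (auto dest: openin_subset)

lemma sets_borel_algebra: "sets (borel_algebra X) = sigma_sets (topspace X) {U. openin X U}"
  unfolding borel_algebra_def by (rule sets_measure_of) (auto dest: openin_subset)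

lemma tendsto_Lim_ultrafilter:
  assumes F: "ultrafilter F" and x: "bounded (range (x :: nat \<Rightarrow> real))"
  shows "(x \<longlongrightarrow> Lim F x) F"
proof -
  obtain B where B: "\<And>n. norm (x n) \<le> B"
    using x by (auto simp: bounded_iff)
  have "\<forall>\<^sub>F y in filtermap x F. y \<in> cball 0 B"
    using B by (simp add: eventually_filtermap)
  moreover have "filtermap x F \<noteq> bot"
    using F by (simp add: ultrafilter_def filtermap_bot_iff)
  ultimately obtain l where l: "inf (nhds l) (filtermap x F) \<noteq> bot"
    using compact_filter[of "cball 0 B :: real set"] by auto
  have "(x \<longlongrightarrow> l) F"
  proof (rule topological_tendstoI)
    fix S assume S: "open S" "l \<in> S"
    show "\<forall>\<^sub>F n in F. x n \<in> S"
    proof (rule ccontr)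
      assume "\<not> (\<forall>\<^sub>F n in F. x n \<in> S)"
      then have "\<forall>\<^sub>F n in F. x n \<notin> S"
        using F[unfolded ultrafilter_def, THEN conjunct2, rule_format, of "x -` S"] by simp
      then have "\<forall>\<^sub>F y in filtermap x F. y \<notin> S"
        by (simp add: eventually_filtermap)
      moreover have "\<forall>\<^sub>F y in nhds l. y \<in> S"
        using S by (simp add: eventually_nhds_in_open)
      ultimately have "\<forall>\<^sub>F y in inf (nhds l) (filtermap x F). False"
        unfolding eventually_inf by blast
      with l show False
        by (simp add: trivial_limit_def)
    qed
  qed
  then show ?thesis
    using F tendsto_Lim[of F x l] by (simp add: ultrafilter_def)
qed

lemma ultrafilter_Lim_abs_le:
  assumes F: "ultrafilter F" and x: "\<And>n. \<bar>x n :: real\<bar> \<le> B"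
  shows "\<bar>Lim F x\<bar> \<le> B"
proof -
  have "bounded (range x)"
    using x by (auto simp: bounded_iff)
  then have "(x \<longlongrightarrow> Lim F x) F"
    by (rule tendsto_Lim_ultrafilter[OF F])
  then have "((\<lambda>n. \<bar>x n\<bar>) \<longlongrightarrow> \<bar>Lim F x\<bar>) F"
    by (rule tendsto_rabs)
  then show ?thesis
    using F x by (intro tendsto_upperbound) (auto simp: ultrafilter_def)
qed

lemma Lim_borel_measurable:
  assumes x: "bounded (range (x :: nat \<Rightarrow> real))"
  shows "(\<lambda>F. Lim F x) \<in> borel_measurable (borel_algebra (Ult_topology I))"
proof (rule borel_measurableI_greater)
  fix t
  let ?M = "borel_algebra (Ult_topology I)"
  have "{F \<in> space ?M. t < Lim F x} = (\<Union>q\<in>{q. t < q}. ultra_clopen {n. q < x n}) \<inter> Ult I"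
    (is "?L = ?R")
  proof (intro equalityI subsetI)
    fix F assume F: "F \<in> ?L"
    then have FU: "F \<in> Ult I" "ultrafilter F" "t < Lim F x"
      by (auto simp: space_borel_Ult Ult_def)
    obtain q where q: "t < q" "q < Lim F x"
      using dense FU(3) by blast
    have "\<forall>\<^sub>F n in F. q < x n"
      using order_tendstoD(1)[OF tendsto_Lim_ultrafilter[OF FU(2) x] q(2)] .
    then show "F \<in> ?R"
      using FU q by (auto simp: ultra_clopen_def)
  next
    fix F assume F: "F \<in> ?R"
    then obtain q where q: "t < q" "\<forall>\<^sub>F n in F. q < x n" "ultrafilter F"
      by (auto simp: ultra_clopen_def)
    have "q \<le> Lim F x"
      by (rule tendsto_lowerbound[OF tendsto_Lim_ultrafilter[OF q(3) x]])
        (use q in \<open>auto simp: ultrafilter_def elim: eventually_mono\<close>)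
    then show "F \<in> ?L"
      using q F by (auto simp: space_borel_Ult)
  qed
  moreover have "openin (Ult_topology I) ?R"
    unfolding Ult_topology_def openin_subtopology
    by (intro exI[of _ "\<Union>q\<in>{q. t < q}. ultra_clopen {n. q < x n}"])
      (auto intro: openin_ultra_clopen)
  ultimately show "{F \<in> space ?M. t < Lim F x} \<in> sets ?M"
    by (simp add: sets_borel_algebra sigma_sets.Basic)
qed

end

theory Submission
  imports Defs
begin

text \<open>
  A capacity only has to be monotone, so a supremum over clopen sets from inside defines one on
  all sets at once. Put \<open>\<mu> A = f(1\<^sub>A)\<close> and let \<open>\<rho> B\<close> be the supremum of \<open>\<mu> A\<close> over all \<open>A\<close> whose clopen trace
  \<open>{F \<in> Ult(I). A \<in> F}\<close> lies inside \<open>B\<close>. Because a set outside \<open>I\<close> belongs to some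
  ultrafilter of \<open>Ult(I)\<close> (\<open>ex_Ult_containing\<close>), an inclusion between the traces of \<open>A\<close> and \<open>B\<close> forces
  \<open>A - B \<in> I\<close> and therefore \<open>\<mu> A \<le> \<mu> B\<close> (\<open>SL_mono_trace\<close>). So \<open>\<rho>\<close> is a normalized capacity.

  The level set \<open>{F. F-lim x \<ge> t}\<close> contains the trace of \<open>{n. x n \<ge> t}\<close> and is contained in the
  trace of \<open>{n. x n \<ge> s}\<close> for every \<open>s < t\<close>. Hence \<open>R t\<close>, its capacity, satisfies
  \<open>\<mu> {x \<ge> t} \<le> R t \<le> \<mu> {x \<ge> s}\<close> (\<open>inner_capacity_level\<close>).
  On the other hand, the truncations \<open>\<phi> t = f (min x t)\<close> satisfy
  \<open>(t - s) \<mu> {x \<ge> t} \<le> \<phi> t - \<phi> s \<le> (t - s) \<mu> {x \<ge> s}\<close> by positivity of \<open>f\<close>, since the same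
  inequalities hold pointwise. Together these give
  \<open>(t - s) R t \<le> \<phi> t - \<phi> s \<le> (t - s) R s\<close>, which for a decreasing \<open>R\<close> means that
  \<open>\<phi>\<close> is a primitive of \<open>R\<close> (\<open>has_integral_antimono_primitive\<close>). Finally \<open>\<phi> b = f x\<close>
  for large \<open>b\<close> and \<open>\<phi> a = a\<close> for small \<open>a\<close>, so the two halves of the Choquet
  integral are \<open>f x - \<phi> 0\<close> and \<open>\<phi> 0\<close>.
\<close>

section \<open>Ultrafilters that avoid an ideal\<close>

text \<open>
  An ideal \<open>J \<supseteq> I\<close> that is maximal among those not containing \<open>A\<close> is prime: if neither
  \<open>B\<close> nor its complement were in \<open>J\<close>, adjoining either of them would put \<open>A\<close> into the ideal, so
  \<open>A \<subseteq> C \<union> B\<close> and \<open>A \<subseteq> C' \<union> - B\<close> with \<open>C, C' \<in> J\<close>, whence \<open>A \<subseteq> C \<union> C'\<close> is in \<open>J\<close>.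
  The complements of the members of a prime ideal form an ultrafilter.
\<close>

lemma ex_Ult_containing:
  assumes I: "ideal_on_omega I" and A: "A \<notin> I"
  obtains F where "F \<in> Ult I" "\<forall>\<^sub>F n in F. n \<in> A"
proof -
  define \<J> where "\<J> = {J. I \<subseteq> J \<and> A \<notin> J \<and> (\<forall>B\<in>J. \<forall>C\<in>J. B \<union> C \<in> J) \<and>
                          (\<forall>B\<in>J. \<forall>C. C \<subseteq> B \<longrightarrow> C \<in> J)}"
  have "\<exists>M\<in>\<J>. \<forall>X\<in>\<J>. M \<subseteq> X \<longrightarrow> X = M"
  proof (rule subset_Zorn_nonempty)
    show "\<J> \<noteq> {}"
      using I A by (auto simp: \<J>_def ideal_on_omega_def)
  next
    fix \<C> assume ne: "\<C> \<noteq> {}" and chain: "subset.chain \<J> \<C>"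
    have sub: "\<C> \<subseteq> \<J>" and tot: "\<And>X Y. X \<in> \<C> \<Longrightarrow> Y \<in> \<C> \<Longrightarrow> X \<subseteq> Y \<or> Y \<subseteq> X"
      using chain by (auto simp: subset_chain_def)
    have un: "B \<union> C \<in> \<Union>\<C>" if BC: "B \<in> \<Union>\<C>" "C \<in> \<Union>\<C>" for B C
    proof -
      obtain X Y where XY: "X \<in> \<C>" "B \<in> X" "Y \<in> \<C>" "C \<in> Y"
        using BC by blast
      then obtain Z where Z: "Z \<in> \<C>" "B \<in> Z" "C \<in> Z"
        using tot[of X Y] by blast
      then have "B \<union> C \<in> Z"
        using sub by (auto simp: \<J>_def)
      then show ?thesis
        using Z(1) by blast
    qed
    have down: "C \<in> \<Union>\<C>" if BC: "B \<in> \<Union>\<C>" "C \<subseteq> B" for B C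
    proof -
      obtain X where X: "X \<in> \<C>" "B \<in> X"
        using BC by blast
      then have "C \<in> X"
        using sub BC(2) by (auto simp: \<J>_def)
      then show ?thesis
        using X(1) by blast
    qed
    have "A \<notin> \<Union>\<C>"
      using sub by (auto simp: \<J>_def)
    moreover have "I \<subseteq> \<Union>\<C>"
    proof -
      obtain X where "X \<in> \<C>"
        using ne by blast
      moreover from this have "I \<subseteq> X"
        using sub by (auto simp: \<J>_def)
      ultimately show ?thesis
        by blast
    qed
    ultimately show "\<Union>\<C> \<in> \<J>"
      unfolding \<J>_def using un down by (intro CollectI conjI ballI allI impI)
  qed
  then obtain M where M: "M \<in> \<J>" and max: "\<And>X. X \<in> \<J> \<Longrightarrow> M \<subseteq> X \<Longrightarrow> X = M"
    by blast
  have IM: "I \<subseteq> M" and AM: "A \<notin> M"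
    and un: "\<And>B C. B \<in> M \<Longrightarrow> C \<in> M \<Longrightarrow> B \<union> C \<in> M"
    and down: "\<And>B C. B \<in> M \<Longrightarrow> C \<subseteq> B \<Longrightarrow> C \<in> M"
    using M by (simp_all add: \<J>_def)
  have empty: "{} \<in> M"
    using I IM by (auto simp: ideal_on_omega_def)
  have cover: "\<exists>C\<in>M. A \<subseteq> C \<union> B" if B: "B \<notin> M" for B
  proof (rule ccontr)
    assume no: "\<not> (\<exists>C\<in>M. A \<subseteq> C \<union> B)"
    define X where "X = {D. \<exists>C\<in>M. D \<subseteq> C \<union> B}"
    have "M \<subseteq> X"
      by (auto simp: X_def)
    have un_X: "D \<union> E \<in> X" if DE: "D \<in> X" "E \<in> X" for D E
    proof -
      obtain C C' where "C \<in> M" "D \<subseteq> C \<union> B" "C' \<in> M" "E \<subseteq> C' \<union> B"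
        using DE unfolding X_def by blast
      then show ?thesis
        unfolding X_def by (intro CollectI bexI[of _ "C \<union> C'"] un) auto
    qed
    have down_X: "E \<in> X" if "D \<in> X" "E \<subseteq> D" for D E
      using that unfolding X_def by blast
    have "A \<notin> X"
      using no by (simp add: X_def)
    then have "X \<in> \<J>"
      unfolding \<J>_def using IM \<open>M \<subseteq> X\<close> un_X down_X
      by (intro CollectI conjI ballI allI impI) auto
    then have "X = M"
      using max \<open>M \<subseteq> X\<close> by blast
    moreover have "B \<in> X"
      using empty unfolding X_def by blast
    ultimately show False
      using B by blast
  qed
  have prime: "B \<in> M \<or> - B \<in> M" for B
  proof (rule ccontr)
    assume "\<not> (B \<in> M \<or> - B \<in> M)"
    then obtain C C' where "C \<in> M" "A \<subseteq> C \<union> B" "C' \<in> M" "A \<subseteq> C' \<union> - B"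
      using cover[of B] cover[of "- B"] by blast
    then have "A \<in> M"
      using down[OF un[of C C'], of A] by blast
    then show False
      using AM by simp
  qed
  define F where "F = Abs_filter (\<lambda>P. {n. \<not> P n} \<in> M)"
  have ev: "eventually P F \<longleftrightarrow> {n. \<not> P n} \<in> M" for P
    unfolding F_def
  proof (rule eventually_Abs_filter[OF is_filter.intro])
    show "{n. \<not> True} \<in> M"
      using empty by simp
    fix P Q
    show "{n. \<not> (P n \<and> Q n)} \<in> M" if "{n. \<not> P n} \<in> M" "{n. \<not> Q n} \<in> M"
      by (rule down[OF un[OF that]]) auto
    show "{n. \<not> Q n} \<in> M" if "\<forall>n. P n \<longrightarrow> Q n" "{n. \<not> P n} \<in> M"
      by (rule down[OF that(2)]) (use that(1) in auto)
  qed
  have [simp]: "{n. n \<notin> B} = - B" for B :: "nat set"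
    by auto
  have "UNIV \<notin> M"
    using AM down[of UNIV A] by blast
  then have "ultrafilter F"
    using prime by (auto simp: ultrafilter_def trivial_limit_def ev)
  then have "F \<in> Ult I"
    using IM by (auto simp: Ult_def ev)
  moreover have "\<forall>\<^sub>F n in F. n \<in> A"
    using prime[of A] AM by (simp add: ev)
  ultimately show ?thesis
    by (rule that)
qed

section \<open>Positive functionals on bounded sequences\<close>

lemma SL_mono:
  assumes f: "f \<in> SL I" and le: "\<And>n. apply_bcontfun x n \<le> apply_bcontfun y n"
  shows "f x \<le> f y"
proof -
  have "0 \<le> f (y - x)"
    using f le by (simp add: SL_def minus_bcontfun.rep_eq)
  then show ?thesis
    using f linear_diff[of f y x] by (simp add: SL_def)
qed

lemma SL_const:
  assumes f: "f \<in> SL I" and x: "\<And>n. apply_bcontfun x n = c"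
  shows "f x = c"
proof -
  have "apply_bcontfun x = (\<lambda>_. c)"
    using x by blast
  moreover have "f x = lim (apply_bcontfun x)"
    using f calculation by (simp add: SL_def convergent_const)
  ultimately show ?thesis
    by simp
qed

lemma SL_char_seq_UNIV: "f \<in> SL I \<Longrightarrow> f (char_seq UNIV) = 1"
  by (rule SL_const) auto

lemma SL_char_seq_le_1: "f \<in> SL I \<Longrightarrow> f (char_seq A) \<le> 1"
  using SL_mono[of f I "char_seq A" "char_seq UNIV"] SL_char_seq_UNIV[of f I]
  by (simp add: indicator_def)

text \<open>
  If the trace of \<open>A\<close> on \<^term>\<open>Ult I\<close> is contained in that of \<open>B\<close>, no ultrafilter of
  \<^term>\<open>Ult I\<close> contains \<open>A - B\<close>. So \<open>A - B\<close> is in the ideal, where the functional vanishes, and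
  \<open>1\<^sub>A \<le> 1\<^sub>B + 1\<^bsub>A - B\<^esub>\<close>.
\<close>

lemma SL_mono_trace:
  assumes I: "ideal_on_omega I" and f: "f \<in> SL I"
    and sub: "Ult I \<inter> ultra_clopen A \<subseteq> Ult I \<inter> ultra_clopen B"
  shows "f (char_seq A) \<le> f (char_seq B)"
proof -
  have "A - B \<in> I"
  proof (rule ccontr)
    assume "A - B \<notin> I"
    then obtain F where F: "F \<in> Ult I" "\<forall>\<^sub>F n in F. n \<in> A - B"
      using ex_Ult_containing[OF I] by blast
    then have "F \<in> Ult I \<inter> ultra_clopen A"
      by (auto simp: Ult_def ultra_clopen_def elim: eventually_mono)
    then have "\<forall>\<^sub>F n in F. n \<in> B" "F \<noteq> bot"
      using sub by (auto simp: ultra_clopen_def ultrafilter_def)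
    moreover have "\<forall>\<^sub>F n in F. n \<notin> B"
      using F(2) by (auto elim: eventually_mono)
    ultimately have "\<forall>\<^sub>F n in F. False"
      using eventually_elim2[of "\<lambda>n. n \<in> B" F "\<lambda>n. n \<notin> B" "\<lambda>_. False"] by simp
    then show False
      using \<open>F \<noteq> bot\<close> by (simp add: trivial_limit_def)
  qed
  then have "f (char_seq (A - B)) = 0"
    using f by (simp add: SL_def)
  moreover have "f (char_seq A) \<le> f (char_seq B + char_seq (A - B))"
    by (rule SL_mono[OF f]) (auto simp: plus_bcontfun.rep_eq indicator_def)
  moreover have "f (char_seq B + char_seq (A - B)) = f (char_seq B) + f (char_seq (A - B))"
    using f by (simp add: SL_def linear_add)
  ultimately show ?thesis
    by simp
qed

section \<open>The inner capacity of a functional\<close>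

definition inner_capacity :: "nat set set \<Rightarrow> (linfty \<Rightarrow> real) \<Rightarrow> nat filter set \<Rightarrow> real" where
  "inner_capacity I f B = (SUP A \<in> {A. Ult I \<inter> ultra_clopen A \<subseteq> B}. f (char_seq A))"

lemma inner_capacity_ge:
  assumes "f \<in> SL I" "Ult I \<inter> ultra_clopen A \<subseteq> B"
  shows "f (char_seq A) \<le> inner_capacity I f B"
  unfolding inner_capacity_def using assms SL_char_seq_le_1[OF assms(1)]
  by (intro cSUP_upper) (auto intro!: bdd_aboveI[of _ 1])

lemma inner_capacity_le:
  assumes "\<And>A. Ult I \<inter> ultra_clopen A \<subseteq> B \<Longrightarrow> f (char_seq A) \<le> c"
  shows "inner_capacity I f B \<le> c"
proof -
  have "ultra_clopen {} = {}"
    by (auto simp: ultra_clopen_def ultrafilter_def trivial_limit_def)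
  \<comment> \<open>The empty set always has its trace inside \<open>B\<close>, so the supremum is over a nonempty set.\<close>
  then show ?thesis
    unfolding inner_capacity_def using assms by (intro cSUP_least) (auto intro!: exI[of _ "{}"])
qed

lemma inner_capacity_mono:
  assumes "f \<in> SL I" "B \<subseteq> C"
  shows "inner_capacity I f B \<le> inner_capacity I f C"
  by (rule inner_capacity_le) (use assms in \<open>auto intro!: inner_capacity_ge\<close>)

lemma normalized_inner_capacity:
  assumes I: "ideal_on_omega I" and f: "f \<in> SL I"
  shows "normalized_capacity (borel_algebra (Ult_topology I)) (inner_capacity I f)"
proof -
  have zero: "f (char_seq {}) = 0"
    using I f by (simp add: SL_def ideal_on_omega_def)
  have "inner_capacity I f {} \<le> 0"
  proof (rule inner_capacity_le)
    fix A assume "Ult I \<inter> ultra_clopen A \<subseteq> {}"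
    then show "f (char_seq A) \<le> 0"
      using SL_mono_trace[OF I f, of A "{}"] zero by auto
  qed
  moreover have "0 \<le> inner_capacity I f {}"
    using inner_capacity_ge[OF f, of "{}" "{}"] zero
    by (auto simp: ultra_clopen_def ultrafilter_def trivial_limit_def)
  moreover have "inner_capacity I f (Ult I) \<le> 1"
    by (rule inner_capacity_le) (rule SL_char_seq_le_1[OF f])
  moreover have "1 \<le> inner_capacity I f (Ult I)"
    using inner_capacity_ge[OF f, of UNIV "Ult I"] SL_char_seq_UNIV[OF f] by auto
  ultimately show ?thesis
    using inner_capacity_mono[OF f] by (simp add: normalized_capacity_def space_borel_Ult)
qed

text \<open>
  The gap between \<open>s\<close> and \<open>t\<close> is unavoidable: the limit of \<open>x\<close> along \<open>F\<close> can equal \<open>t\<close> although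
  \<open>x n < t\<close> for all \<open>n\<close>.
\<close>

lemma inner_capacity_level:
  fixes x :: "nat \<Rightarrow> real"
  assumes I: "ideal_on_omega I" and f: "f \<in> SL I" and x: "bounded (range x)"
  shows "f (char_seq {n. t \<le> x n}) \<le> inner_capacity I f {F \<in> Ult I. t \<le> Lim F x}"
    and "s < t \<Longrightarrow> inner_capacity I f {F \<in> Ult I. t \<le> Lim F x} \<le> f (char_seq {n. s \<le> x n})"
proof -
  have "t \<le> Lim F x" if "F \<in> Ult I \<inter> ultra_clopen {n. t \<le> x n}" for F
    by (rule tendsto_lowerbound[OF tendsto_Lim_ultrafilter[of F x]])
      (use that x in \<open>auto simp: ultra_clopen_def ultrafilter_def\<close>)
  then show "f (char_seq {n. t \<le> x n}) \<le> inner_capacity I f {F \<in> Ult I. t \<le> Lim F x}"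
    by (intro inner_capacity_ge[OF f]) blast
next
  assume st: "s < t"
  have "F \<in> ultra_clopen {n. s \<le> x n}" if F: "F \<in> Ult I" "t \<le> Lim F x" for F
  proof -
    have U: "ultrafilter F"
      using F by (simp add: Ult_def)
    have "\<forall>\<^sub>F n in F. s < x n"
      by (rule order_tendstoD(1)[OF tendsto_Lim_ultrafilter[OF U x]]) (use F st in simp)
    then show ?thesis
      using U by (auto simp: ultra_clopen_def elim: eventually_mono)
  qed
  then show "inner_capacity I f {F \<in> Ult I. t \<le> Lim F x} \<le> f (char_seq {n. s \<le> x n})"
    by (intro inner_capacity_le SL_mono_trace[OF I f]) blast
qed

section \<open>Primitives of decreasing functions\<close>

text \<open>
  On a partition into \<open>n\<close> intervals of length \<open>(b - a) / n\<close> the increments of \<open>D\<close> are bounded by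
  \<open>(b - a) / n\<close> times the decrements of \<open>R\<close>; these telescope, and \<open>n\<close> is arbitrary.
\<close>

lemma eq_if_increments_le:
  fixes D R :: "real \<Rightarrow> real"
  assumes ab: "a \<le> b"
    and inc: "\<And>s t. a \<le> s \<Longrightarrow> s \<le> t \<Longrightarrow> t \<le> b \<Longrightarrow> \<bar>D t - D s\<bar> \<le> (t - s) * (R s - R t)"
  shows "D b = D a"
proof -
  have bound: "\<bar>D b - D a\<bar> \<le> (b - a) * (R a - R b) / real n" if n: "n > 0" for n
  proof -
    define h where "h = (b - a) / real n"
    define p where "p i = a + real i * h" for i
    have h: "0 \<le> h"
      using ab by (simp add: h_def)
    have pn: "p n = b"
      using n by (simp add: p_def h_def)
    have step: "\<bar>D (p (Suc i)) - D (p i)\<bar> \<le> h * (R (p i) - R (p (Suc i)))" if "i < n" for i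
    proof -
      have "p (Suc i) \<le> p n"
        using h that by (auto simp: p_def intro!: mult_right_mono)
      then have "\<bar>D (p (Suc i)) - D (p i)\<bar> \<le> (p (Suc i) - p i) * (R (p i) - R (p (Suc i)))"
        using h pn by (intro inc) (auto simp: p_def algebra_simps)
      then show ?thesis
        by (simp add: p_def algebra_simps)
    qed
    have "D b - D a = (\<Sum>i<n. D (p (Suc i)) - D (p i))"
      unfolding sum_lessThan_telescope[of "\<lambda>i. D (p i)"] pn by (simp add: p_def)
    also have "\<bar>\<dots>\<bar> \<le> (\<Sum>i<n. h * (R (p i) - R (p (Suc i))))"
      by (rule order_trans[OF sum_abs sum_mono]) (use step in auto)
    also have "\<dots> = h * (\<Sum>i<n. R (p i) - R (p (Suc i)))"
      by (simp add: sum_distrib_left)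
    also have "\<dots> = h * (R a - R b)"
      unfolding sum_lessThan_telescope'[of "\<lambda>i. R (p i)"] pn by (simp add: p_def)
    finally show ?thesis
      by (simp add: h_def)
  qed
  have "\<bar>D b - D a\<bar> \<le> 0"
  proof (rule tendsto_lowerbound)
    show "(\<lambda>n. (b - a) * (R a - R b) / real n) \<longlonglongrightarrow> 0"
      by (rule lim_const_over_n)
    show "\<forall>\<^sub>F n in sequentially. \<bar>D b - D a\<bar> \<le> (b - a) * (R a - R b) / real n"
      using eventually_gt_at_top[of 0] by eventually_elim (rule bound)
  qed simp
  then show ?thesis
    by simp
qed

text \<open>
  Both \<open>\<phi> t - \<phi> s\<close> and the integral of \<open>R\<close> over \<open>[s, t]\<close> lie between \<open>(t - s) R t\<close> and
  \<open>(t - s) R s\<close>, so their difference satisfies the hypothesis of \<open>eq_if_increments_le\<close>.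
\<close>

lemma has_integral_antimono_primitive:
  fixes R \<phi> :: "real \<Rightarrow> real"
  assumes ab: "a \<le> b" and anti: "antimono R"
    and lower: "\<And>s t. s \<le> t \<Longrightarrow> (t - s) * R t \<le> \<phi> t - \<phi> s"
    and upper: "\<And>s t. s \<le> t \<Longrightarrow> \<phi> t - \<phi> s \<le> (t - s) * R s"
  shows "(R has_integral \<phi> b - \<phi> a) {a..b}"
proof -
  have int: "R integrable_on {s..t}" for s t
  proof -
    have "(\<lambda>u. - R u) integrable_on {s..t}"
      using anti by (intro integrable_on_mono_on) (auto simp: mono_on_def antimono_def)
    then show ?thesis
      using integrable_neg by fastforce
  qed
  define D where "D t = \<phi> t - integral {a..t} R" for t
  have "D b = D a"
  proof (rule eq_if_increments_le[OF ab])
    fix s t assume st: "a \<le> s" "s \<le> t" "t \<le> b"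
    have split: "integral {a..t} R = integral {a..s} R + integral {s..t} R"
      using Henstock_Kurzweil_Integration.integral_combine[OF st(1,2) int] by simp
    have "integral {s..t} (\<lambda>_. R t) \<le> integral {s..t} R"
      using anti by (intro integral_le int integrable_const_ivl) (auto simp: antimono_def)
    moreover have "integral {s..t} R \<le> integral {s..t} (\<lambda>_. R s)"
      using anti by (intro integral_le int integrable_const_ivl) (auto simp: antimono_def)
    ultimately have "(t - s) * R t \<le> integral {s..t} R" "integral {s..t} R \<le> (t - s) * R s"
      using st by simp_all
    then show "\<bar>D t - D s\<bar> \<le> (t - s) * (R s - R t)"
      using lower[OF st(2)] upper[OF st(2)] split by (simp add: D_def right_diff_distrib)
  qed
  then show ?thesis
    using int[of a b] by (simp add: D_def has_integral_iff)
qed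

section \<open>Truncations and the representation\<close>

definition truncate_above :: "linfty \<Rightarrow> real \<Rightarrow> linfty" where
  "truncate_above x t = Bcontfun (\<lambda>n. min (apply_bcontfun x n) t)"

lemma apply_truncate_above [simp]:
  "apply_bcontfun (truncate_above x t) = (\<lambda>n. min (apply_bcontfun x n) t)"
proof -
  have "bounded (range (\<lambda>n. min (apply_bcontfun x n) t))"
  proof (rule boundedI[of _ "norm x + \<bar>t\<bar>"])
    fix y assume "y \<in> range (\<lambda>n. min (apply_bcontfun x n) t)"
    then obtain n where "y = min (apply_bcontfun x n) t"
      by blast
    then show "norm y \<le> norm x + \<bar>t\<bar>"
      using norm_bounded[of x n] by (auto simp: min_def)
  qed
  then show ?thesis
    by (simp add: truncate_above_def Bcontfun_inverse bounded_sequence_bcontfun)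
qed

text \<open>
  These are the pointwise bounds
  \<open>(t - s) 1\<^bsub>{x \<ge> t}\<^esub> \<le> min x t - min x s \<le> (t - s) 1\<^bsub>{x \<ge> s}\<^esub>\<close>, seen through \<open>f\<close>.
\<close>

lemma SL_truncate_above_diff:
  assumes f: "f \<in> SL I" and st: "s \<le> t"
  shows "(t - s) * f (char_seq {n. t \<le> apply_bcontfun x n})
           \<le> f (truncate_above x t) - f (truncate_above x s)"
    and "f (truncate_above x t) - f (truncate_above x s)
           \<le> (t - s) * f (char_seq {n. s \<le> apply_bcontfun x n})"
proof -
  have lin: "linear f"
    using f by (simp add: SL_def)
  have "f ((t - s) *\<^sub>R char_seq {n. t \<le> apply_bcontfun x n})
          \<le> f (truncate_above x t - truncate_above x s)"
    by (rule SL_mono[OF f])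
      (use st in \<open>auto simp: minus_bcontfun.rep_eq scaleR_bcontfun.rep_eq indicator_def\<close>)
  then show "(t - s) * f (char_seq {n. t \<le> apply_bcontfun x n})
               \<le> f (truncate_above x t) - f (truncate_above x s)"
    by (simp add: linear_diff[OF lin] linear_scale[OF lin])
  have "f (truncate_above x t - truncate_above x s)
          \<le> f ((t - s) *\<^sub>R char_seq {n. s \<le> apply_bcontfun x n})"
    by (rule SL_mono[OF f])
      (use st in \<open>auto simp: minus_bcontfun.rep_eq scaleR_bcontfun.rep_eq indicator_def\<close>)
  then show "f (truncate_above x t) - f (truncate_above x s)
               \<le> (t - s) * f (char_seq {n. s \<le> apply_bcontfun x n})"
    by (simp add: linear_diff[OF lin] linear_scale[OF lin])
qed

lemma has_integral_level_capacity:
  fixes x :: linfty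
  assumes I: "ideal_on_omega I" and f: "f \<in> SL I" and ab: "a \<le> b"
  shows "((\<lambda>t. inner_capacity I f {F \<in> Ult I. t \<le> Lim F (apply_bcontfun x)}) has_integral
           f (truncate_above x b) - f (truncate_above x a)) {a..b}"
proof (rule has_integral_antimono_primitive[OF ab])
  let ?R = "\<lambda>t. inner_capacity I f {F \<in> Ult I. t \<le> Lim F (apply_bcontfun x)}"
  let ?\<phi> = "\<lambda>t. f (truncate_above x t)"
  let ?\<mu> = "\<lambda>t. f (char_seq {n. t \<le> apply_bcontfun x n})"
  have low: "?\<mu> t \<le> ?R t" and up: "s < t \<Longrightarrow> ?R t \<le> ?\<mu> s" for s t
    using inner_capacity_level[OF I f bounded_apply_bcontfun] by blast+
  show "antimono ?R"
    by (intro antimonoI inner_capacity_mono[OF f]) auto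
  show "?\<phi> t - ?\<phi> s \<le> (t - s) * ?R s" if "s \<le> t" for s t
  proof -
    have "(t - s) * ?\<mu> s \<le> (t - s) * ?R s"
      using that low by (intro mult_left_mono) auto
    then show ?thesis
      using SL_truncate_above_diff(2)[OF f that, of x] by linarith
  qed
  show "(t - s) * ?R t \<le> ?\<phi> t - ?\<phi> s" if "s \<le> t" for s t
  proof (cases "s = t")
    case False
    then have st: "s < t"
      using that by simp
    \<comment> \<open>\<open>R t\<close> is only bounded by \<open>\<mu> u\<close> for \<open>u < t\<close>, so the bound is first shown with \<open>u\<close> in place of
      \<open>t\<close> on the left, and then \<open>u\<close> tends to \<open>t\<close>.\<close>
    have below: "(u - s) * ?R t \<le> ?\<phi> t - ?\<phi> s" if u: "s < u" "u < t" for u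
    proof -
      have "(u - s) * ?R t \<le> (u - s) * ?\<mu> u"
        using u up[of u t] by (intro mult_left_mono) auto
      also have "\<dots> \<le> ?\<phi> u - ?\<phi> s"
        using SL_truncate_above_diff(1)[OF f, of s u x] u by simp
      also have "\<dots> \<le> ?\<phi> t - ?\<phi> s"
        using SL_mono[OF f, of "truncate_above x u" "truncate_above x t"] u
        by (simp add: min_le_iff_disj)
      finally show ?thesis .
    qed
    show ?thesis
    proof (rule tendsto_upperbound)
      show "((\<lambda>u. (u - s) * ?R t) \<longlongrightarrow> (t - s) * ?R t) (at_left t)"
        by (intro tendsto_intros)
      show "\<forall>\<^sub>F u in at_left t. (u - s) * ?R t \<le> ?\<phi> t - ?\<phi> s"
        using eventually_at_left_real[OF st] by eventually_elim (auto intro: below)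
    qed simp
  qed simp
qed

text \<open>
  Beyond the bound \<^term>\<open>norm x\<close> truncation does nothing on the right and yields the constant
  sequence \<open>t\<close> on the left, so both improper integrals are eventually constant.
\<close>

lemma SL_eq_choquet_integral:
  fixes x :: linfty
  assumes I: "ideal_on_omega I" and f: "f \<in> SL I"
  shows "f x = choquet_integral (borel_algebra (Ult_topology I)) (inner_capacity I f)
                 (\<lambda>F. Lim F (apply_bcontfun x))"
proof -
  let ?R = "\<lambda>t. inner_capacity I f {F \<in> Ult I. t \<le> Lim F (apply_bcontfun x)}"
  let ?\<phi> = "\<lambda>t. f (truncate_above x t)"
  have bnd: "\<bar>apply_bcontfun x n\<bar> \<le> norm x" for n
    using norm_bounded[of x n] by simp
  have right: "?\<phi> b = f x" if "norm x \<le> b" for b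
  proof -
    have "truncate_above x b = x"
    proof (rule bcontfun_eqI)
      show "apply_bcontfun (truncate_above x b) n = apply_bcontfun x n" for n
        using bnd[of n] that by simp
    qed
    then show ?thesis
      by simp
  qed
  have left: "?\<phi> a = a" if "a \<le> - norm x" for a
  proof (rule SL_const[OF f])
    show "apply_bcontfun (truncate_above x a) n = a" for n
      using bnd[of n] that by simp
  qed
  have "integral {0..b} ?R = f x - ?\<phi> 0" if "norm x \<le> b" for b
    using has_integral_level_capacity[OF I f, of 0 b x] that right[OF that]
      order_trans[OF norm_ge_zero that]
    by (simp add: has_integral_iff)
  then have "\<forall>\<^sub>F b in at_top. integral {0..b} ?R = f x - ?\<phi> 0"
    by (auto simp: eventually_at_top_linorder)
  then have pos: "Lim at_top (\<lambda>b. integral {0..b} ?R) = f x - ?\<phi> 0"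
    by (intro tendsto_Lim tendsto_eventually) auto
  have "integral {a..0} (\<lambda>t. ?R t - 1) = ?\<phi> 0" if a: "a \<le> - norm x" for a
  proof -
    have a0: "a \<le> 0"
      using a norm_ge_zero[of x] by linarith
    have "((\<lambda>t. ?R t - 1) has_integral (?\<phi> 0 - ?\<phi> a) - (0 - a) *\<^sub>R 1) {a..0}"
      using has_integral_const_real[of "1::real" a 0] a0
      by (intro has_integral_diff has_integral_level_capacity[OF I f]) auto
    then show ?thesis
      using left[OF a] by (simp add: has_integral_iff)
  qed
  then have "\<forall>\<^sub>F a in at_bot. integral {a..0} (\<lambda>t. ?R t - 1) = ?\<phi> 0"
    by (auto simp: eventually_at_bot_linorder)
  then have neg: "Lim at_bot (\<lambda>a. integral {a..0} (\<lambda>t. ?R t - 1)) = ?\<phi> 0"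
    by (intro tendsto_Lim tendsto_eventually) auto
  have "inner_capacity I f (Ult I) = 1"
    using normalized_inner_capacity[OF I f] by (simp add: normalized_capacity_def space_borel_Ult)
  then show ?thesis
    using pos neg by (simp add: choquet_integral_def space_borel_Ult)
qed

theorem theorem2p1:
  fixes I :: "nat set set"
  assumes "ideal_on_omega I"
  shows "\<forall>f\<in>SL I. \<exists>\<rho> :: nat filter set \<Rightarrow> real.
           normalized_capacity (borel_algebra (Ult_topology I)) \<rho> \<and>
           (\<forall>x :: linfty.
              f x = choquet_integral (borel_algebra (Ult_topology I)) \<rho>
                      (\<lambda>F. Lim F (apply_bcontfun x)))"
  using normalized_inner_capacity[OF assms] SL_eq_choquet_integral[OF assms] by blast

end
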